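(* Let $\kappa\in\mathbb{Z}_+$ and $\theta\in\mathbb{N}$. Let $\boldsymbol\lambda=\{\lambda_v\}_{v\in V_{\kappa,\theta}^\circ}\subseteq\mathbb{C}\setminus\{0\}$ satisfy $\lambda_{(1,j)}=\lambda_{(2,j)}=:\lambda_j$ for every $j\in J_\theta$. Then the weighted shift operator $S_{\boldsymbol\lambda}$ on the directed tree $\mathscr{T}_{\kappa,\theta}=(V_{\kappa,\theta},E_{\kappa,\theta})$ is complex symmetric if and only if the following conditions are satisfied: (i) $|\lambda_{1+j}|=|\lambda_{\theta+1-j}|$ for every $j\in J_{\theta-1}$; (ii) if $\theta-\kappa=1$, then $|\lambda_{-\kappa+j}|=|\lambda_{\theta-j+1}|$ for every $j\in J_{\kappa+\theta}$; (iii) if $\theta-\kappa\neq 1$, then $\sqrt{2}\,|\lambda_1|=|\lambda_{\theta-\kappa}|$ and $|\lambda_{-\kappa+j}|=|\lambda_{\theta-j+1}|$ for every $j\in J_{\kappa+\theta}\setminus\{\kappa+1,\theta\}$.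
   Context: Notation: $\mathbb{N}=\{1,2,3,\ldots\}$, $\mathbb{Z}_+=\mathbb{N}\cup\{0\}$, and $J_n=\{k\in\mathbb{N}: k\leqslant n\}$ for $n\in\mathbb{Z}_+$ (so $J_0=\emptyset$). The directed tree $\mathscr{T}_{\kappa,\theta}=(V_{\kappa,\theta},E_{\kappa,\theta})$ has vertex set $$V_{\kappa,\theta}=\{-k: k\in J_\kappa\}\cup\{0\}\cup\{(i,j): i\in\{1,2\},\ j\in J_\theta\}$$ and edge set $$E_{\kappa,\theta}=\{(-k,-k+1): k\in J_\kappa\}\cup\{(0,(1,1)),(0,(2,1))\}\cup\{((i,j),(i,j+1)): i\in\{1,2\},\ j\in J_{\theta-1}\},$$ where an edge $(u,v)$ goes from $u$ to $v$. Its root (the unique vertex without a parent) is $-\kappa$, and $V_{\kappa,\theta}^\circ=V_{\kappa,\theta}\setminus\{-\kappa\}$. Every $v\in V_{\kappa,\theta}^\circ$ has a unique parent $\mathrm{par}(v)$, i.e. the unique $u$ with $(u,v)\in E_{\kappa,\theta}$. In the claim, $\lambda_j$ with $1\leqslant j\leqslant\theta$ denotes the common weight $\lambda_{(1,j)}=\lambda_{(2,j)}$, while $\lambda_j$ with $-\kappa+1\leqslant j\leqslant 0$ denotes the weight of the vertex $j\in V_{\kappa,\theta}^\circ$. The weighted shift $S_{\boldsymbol\lambda}$ on $\mathscr{T}_{\kappa,\theta}$ with weights $\boldsymbol\lambda$ is the bounded linear operator on $\ell^2(V_{\kappa,\theta})$ (the finite-dimensional Hilbert space of complex functions on $V_{\kappa,\theta}$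 with the standard inner product) given by $(S_{\boldsymbol\lambda}f)(v)=\lambda_v f(\mathrm{par}(v))$ for $v\in V_{\kappa,\theta}^\circ$, and $(S_{\boldsymbol\lambda}f)(v)=0$ if $v$ is the root. A conjugation on a complex Hilbert space $\mathcal{H}$ is an antilinear map $C:\mathcal{H}\to\mathcal{H}$ with $C^2=I$ and $\langle Cf,Cg\rangle=\langle g,f\rangle$ for all $f,g\in\mathcal{H}$. A bounded operator $T$ on $\mathcal{H}$ is $C$-symmetric if $T=CT^*C$; it is complex symmetric if it is $C$-symmetric for some conjugation $C$ on $\mathcal{H}$. *)

theory Defs
  imports Complex_Main "HOL-Library.FuncSet"
begin

datatype vertex = Trunk int | Branch nat nat

definition verts :: "nat \<Rightarrow> nat \<Rightarrow> vertex set" where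
  "verts \<kappa> \<theta> = {Trunk (- int k) |k. k \<in> {1..\<kappa>}} \<union> {Trunk 0}
     \<union> {Branch i j |i j. i \<in> {1, 2} \<and> j \<in> {1..\<theta>}}"

definition edges :: "nat \<Rightarrow> nat \<Rightarrow> (vertex \<times> vertex) set" where
  "edges \<kappa> \<theta> = {(Trunk (- int k), Trunk (- int k + 1)) |k. k \<in> {1..\<kappa>}}
     \<union> {(Trunk 0, Branch 1 1), (Trunk 0, Branch 2 1)}
     \<union> {(Branch i j, Branch i (j + 1)) |i j. i \<in> {1, 2} \<and> j \<in> {1..\<theta> - 1}}"

definition root_vertex :: "nat \<Rightarrow> vertex" where
  "root_vertex \<kappa> = Trunk (- int \<kappa>)"

definition nonroot_verts :: "nat \<Rightarrow> nat \<Rightarrow> vertex set" where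
  "nonroot_verts \<kappa> \<theta> = verts \<kappa> \<theta> - {root_vertex \<kappa>}"

definition parent :: "nat \<Rightarrow> nat \<Rightarrow> vertex \<Rightarrow> vertex" where
  "parent \<kappa> \<theta> v = (THE u. (u, v) \<in> edges \<kappa> \<theta>)"

lemma finite_verts: "finite (verts \<kappa> \<theta>)"
proof -
  have "verts \<kappa> \<theta> \<subseteq> (\<lambda>k. Trunk (- int k)) ` {..\<kappa>}
      \<union> (\<lambda>(i, j). Branch i j) ` ({1, 2} \<times> {1..\<theta>})"
    unfolding verts_def by (auto simp: image_iff)
  then show ?thesis
    by (rule finite_subset) simp
qed

lemma edges_in_verts:
  assumes "1 \<le> \<theta>"
  shows "edges \<kappa> \<theta> \<subseteq> verts \<kappa> \<theta> \<times> nonroot_verts \<kappa> \<theta>"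
proof -
  have "Trunk (- int k + 1) \<in> nonroot_verts \<kappa> \<theta>" if "k \<in> {1..\<kappa>}" for k
  proof (cases "k = 1")
    case True
    then show ?thesis
      using that by (auto simp: nonroot_verts_def verts_def root_vertex_def)
  next
    case False
    with that obtain m where "k = Suc m" "1 \<le> m"
      by (cases k) auto
    then show ?thesis
      using that by (auto simp: nonroot_verts_def verts_def root_vertex_def)
  qed
  then show ?thesis
    using assms unfolding edges_def
    by (auto simp: nonroot_verts_def verts_def root_vertex_def; metis)
qed

lemma ex1_parent:
  assumes "v \<in> nonroot_verts \<kappa> \<theta>"
  shows "\<exists>!u. (u, v) \<in> edges \<kappa> \<theta>"
proof (cases v)
  case (Trunk x)
  with assms obtain k where k: "x = - int k" "k < \<kappa>"
    by (force simp: nonroot_verts_def verts_def root_vertex_def)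
  show ?thesis
  proof (rule ex1I)
    show "(Trunk (- int (Suc k)), v) \<in> edges \<kappa> \<theta>"
      using k Trunk unfolding edges_def by force
  qed (use k Trunk in \<open>auto simp: edges_def\<close>)
next
  case (Branch i j)
  with assms have ij: "i \<in> {1, 2}" "j \<in> {1..\<theta>}"
    by (auto simp: nonroot_verts_def verts_def)
  show ?thesis
  proof (cases "j = 1")
    case True
    with Branch ij show ?thesis
      by (auto simp: edges_def)
  next
    case False
    show ?thesis
    proof (rule ex1I)
      show "(Branch i (j - 1), v) \<in> edges \<kappa> \<theta>"
        using False ij Branch unfolding edges_def by force
    qed (use False Branch in \<open>auto simp: edges_def\<close>)
  qed
qed

text \<open>
  For a finite set \<open>V\<close>, the Hilbert space of complex functions on \<open>V\<close> is modelled by the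
  functions vanishing outside \<open>V\<close>.
\<close>

definition l2 :: "'v set \<Rightarrow> ('v \<Rightarrow> complex) set" where
  "l2 V = {f. \<forall>v. v \<notin> V \<longrightarrow> f v = 0}"

definition l2_inner :: "'v set \<Rightarrow> ('v \<Rightarrow> complex) \<Rightarrow> ('v \<Rightarrow> complex) \<Rightarrow> complex" where
  "l2_inner V f g = (\<Sum>v\<in>V. f v * cnj (g v))"

text \<open>Boundedness is automatic here, since the spaces are used for finite \<open>V\<close> only.\<close>

definition l2_operator :: "'v set \<Rightarrow> (('v \<Rightarrow> complex) \<Rightarrow> ('v \<Rightarrow> complex)) \<Rightarrow> bool" where
  "l2_operator V T \<longleftrightarrow> T \<in> l2 V \<rightarrow> l2 V \<and>
     (\<forall>f\<in>l2 V. \<forall>g\<in>l2 V. \<forall>a b. T (\<lambda>v. a * f v + b * g v) = (\<lambda>v. a * T f v + b * T g v))"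

definition l2_adjoint ::
    "'v set \<Rightarrow> (('v \<Rightarrow> complex) \<Rightarrow> ('v \<Rightarrow> complex)) \<Rightarrow> ('v \<Rightarrow> complex) \<Rightarrow> ('v \<Rightarrow> complex)" where
  "l2_adjoint V T g = (THE h. h \<in> l2 V \<and> (\<forall>f\<in>l2 V. l2_inner V (T f) g = l2_inner V f h))"

definition conjugation :: "'v set \<Rightarrow> (('v \<Rightarrow> complex) \<Rightarrow> ('v \<Rightarrow> complex)) \<Rightarrow> bool" where
  "conjugation V C \<longleftrightarrow> C \<in> l2 V \<rightarrow> l2 V \<and>
     (\<forall>f\<in>l2 V. \<forall>g\<in>l2 V. \<forall>a b.
        C (\<lambda>v. a * f v + b * g v) = (\<lambda>v. cnj a * C f v + cnj b * C g v)) \<and>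
     (\<forall>f\<in>l2 V. C (C f) = f) \<and>
     (\<forall>f\<in>l2 V. \<forall>g\<in>l2 V. l2_inner V (C f) (C g) = l2_inner V g f)"

definition C_symmetric ::
    "'v set \<Rightarrow> (('v \<Rightarrow> complex) \<Rightarrow> ('v \<Rightarrow> complex)) \<Rightarrow> (('v \<Rightarrow> complex) \<Rightarrow> ('v \<Rightarrow> complex)) \<Rightarrow> bool"
  where
  "C_symmetric V C T \<longleftrightarrow> l2_operator V T \<and> (\<forall>f\<in>l2 V. T f = C (l2_adjoint V T (C f)))"

definition complex_symmetric ::
    "'v set \<Rightarrow> (('v \<Rightarrow> complex) \<Rightarrow> ('v \<Rightarrow> complex)) \<Rightarrow> bool" where
  "complex_symmetric V T \<longleftrightarrow> (\<exists>C. conjugation V C \<and> C_symmetric V C T)"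

lemma ex1_l2_adjoint:
  fixes V :: "'v set"
  assumes "finite V" "l2_operator V T"
  shows "\<exists>!h. h \<in> l2 V \<and> (\<forall>f\<in>l2 V. l2_inner V (T f) g = l2_inner V f h)"
proof (rule ex1I)
  define e :: "'v \<Rightarrow> 'v \<Rightarrow> complex" where "e = (\<lambda>w v. if v = w then 1 else 0)"
  have e: "e w \<in> l2 V" if "w \<in> V" for w
    using that by (auto simp: e_def l2_def)
  have inner_e: "l2_inner V (e w) h = cnj (h w)" if "w \<in> V" for w h
    using that assms(1) by (simp add: l2_inner_def e_def if_distrib[of "\<lambda>x. x * _"] sum.delta cong: if_cong)
  define h where "h = (\<lambda>w. if w \<in> V then cnj (l2_inner V (T (e w)) g) else 0)"
  have lin: "T (\<lambda>v. a * f v + b * k v) = (\<lambda>v. a * T f v + b * T k v)"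
    if "f \<in> l2 V" "k \<in> l2 V" for f k a b
    using assms(2) that by (simp add: l2_operator_def)
  have zero: "T (\<lambda>v. 0) = (\<lambda>v. 0)"
    using lin[of "\<lambda>v. 0" "\<lambda>v. 0" 0 0] by (simp add: l2_def)
  have T_sum: "l2_inner V (T (\<lambda>v. \<Sum>w\<in>A. f w * e w v)) g = (\<Sum>w\<in>A. f w * l2_inner V (T (e w)) g)"
    if "finite A" "A \<subseteq> V" for A f
    using that
  proof (induction A)
    case empty
    then show ?case by (simp add: zero l2_inner_def)
  next
    case (insert x A)
    have "(\<lambda>v. \<Sum>w\<in>A. f w * e w v) \<in> l2 V"
      using insert.prems by (auto simp: l2_def e_def intro!: sum.neutral)
    then have "T (\<lambda>v. \<Sum>w\<in>insert x A. f w * e w v) =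
        (\<lambda>v. f x * T (e x) v + T (\<lambda>v. \<Sum>w\<in>A. f w * e w v) v)"
      using lin[of "e x" "\<lambda>v. \<Sum>w\<in>A. f w * e w v" "f x" 1] e insert by simp
    then have "l2_inner V (T (\<lambda>v. \<Sum>w\<in>insert x A. f w * e w v)) g =
        f x * l2_inner V (T (e x)) g + l2_inner V (T (\<lambda>v. \<Sum>w\<in>A. f w * e w v)) g"
      by (simp add: l2_inner_def distrib_right sum.distrib sum_distrib_left mult.assoc)
    with insert show ?case by simp
  qed
  have "l2_inner V (T f) g = l2_inner V f h" if "f \<in> l2 V" for f
  proof -
    have "(\<lambda>v. \<Sum>w\<in>V. f w * e w v) = f"
      using that assms(1)
      by (auto simp: fun_eq_iff e_def l2_def if_distrib[of "\<lambda>x. _ * x"] sum.delta' cong: if_cong)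
    with T_sum[OF assms(1) subset_refl, of f] show ?thesis
      by (simp add: l2_inner_def[of V f] h_def)
  qed
  then show "h \<in> l2 V \<and> (\<forall>f\<in>l2 V. l2_inner V (T f) g = l2_inner V f h)"
    by (simp add: h_def l2_def)
  fix k assume k: "k \<in> l2 V \<and> (\<forall>f\<in>l2 V. l2_inner V (T f) g = l2_inner V f k)"
  have "k w = h w" for w
  proof (cases "w \<in> V")
    case True
    then have "l2_inner V (T (e w)) g = cnj (k w)"
      using k e inner_e by simp
    with True show ?thesis by (simp add: h_def)
  next
    case False
    then show ?thesis using k by (simp add: h_def l2_def)
  qed
  then show "k = h" by auto
qed

definition weighted_shift ::
    "nat \<Rightarrow> nat \<Rightarrow> (vertex \<Rightarrow> complex) \<Rightarrow> (vertex \<Rightarrow> complex) \<Rightarrow> (vertex \<Rightarrow> complex)" where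
  "weighted_shift \<kappa> \<theta> lam f =
     (\<lambda>v. if v \<in> nonroot_verts \<kappa> \<theta> then lam v * f (parent \<kappa> \<theta> v) else 0)"

lemma l2_operator_weighted_shift: "l2_operator (verts \<kappa> \<theta>) (weighted_shift \<kappa> \<theta> lam)"
  by (auto simp: l2_operator_def l2_def weighted_shift_def nonroot_verts_def algebra_simps)

text \<open>
  The weight \<open>\<lambda>\<^sub>j\<close> for an integer index \<open>j\<close>: the weight of the trunk vertex \<open>j\<close> if \<open>j \<le> 0\<close>,
  and the weight of the \<open>j\<close>-th vertex of the first branch if \<open>j > 0\<close> (the two branches are
  assumed to carry the same weights wherever this is used).
\<close>

definition weight_at :: "(vertex \<Rightarrow> complex) \<Rightarrow> int \<Rightarrow> complex" where
  "weight_at lam j = (if j \<le> 0 then lam (Trunk j) else lam (Branch 1 (nat j)))"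

end

theory Submission
  imports Defs
begin

text \<open>
  Because both branches carry the same weights, the shift commutes with exchanging them and hence
  splits into its restrictions to the symmetric and to the antisymmetric functions.  In the
  normalized orthogonal basis of delta functions on the trunk and of sums and differences of the
  two deltas at each level of the branches, these restrictions are truncated weighted shifts on
  chains.  The symmetric chain has the weights
  \<open>\<lambda>\<^bsub>-\<kappa>+1\<^esub>, \<dots>, \<lambda>\<^sub>0, sqrt 2 * \<lambda>\<^sub>1, \<lambda>\<^sub>2, \<dots>, \<lambda>\<^bsub>\<theta>\<^esub>\<close>, where the factor \<open>sqrt 2\<close>
  comes from the branching vertex, and the antisymmetric chain has the weights
  \<open>\<lambda>\<^sub>2, \<dots>, \<lambda>\<^bsub>\<theta>\<^esub>\<close>.

  The heart of the matter is a criterion for direct sums of truncated weighted shifts with nonzero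
  weights whose chains have pairwise distinct lengths
  (\<open>complex_symmetric_iff_palindromic\<close>): such an operator is complex symmetric if and only if
  the moduli of the weights of each chain form a palindrome.  Both directions rest on
  \<open>C_symmetric_iff_bilinear\<close>, which says that \<open>T\<close> is \<open>C\<close>-symmetric precisely when it is symmetric
  for the bilinear form \<open>\<langle>f, C g\<rangle>\<close>.  If this holds, then \<open>C\<close> must reverse each chain up to
  unimodular factors, as one sees by going from the longest chain to the shortest, and then each
  weight has the same modulus as its mirror image.  Conversely, for palindromic moduli, phases can
  be chosen that turn the reversal of the chains into a suitable conjugation.

  Here the chains have \<open>\<kappa> + \<theta>\<close> and \<open>\<theta> - 1\<close> weights, two numbers that are always different.  The
  palindrome condition for the antisymmetric chain is the first condition of the theorem.  For the
  symmetric chain, the weight \<open>sqrt 2 * \<lambda>\<^sub>1\<close> is mirrored to the position of \<open>\<lambda>\<^bsub>\<theta>-\<kappa>\<^esub>\<close>, which is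
  its own position exactly if \<open>\<theta> - \<kappa> = 1\<close>; this is the case distinction between the other two
  conditions (\<open>palindrome_with_scaled_entry\<close>).
\<close>

section \<open>Conjugations on spaces of functions on finite sets\<close>

lemma l2_inner_commute: "l2_inner V f g = cnj (l2_inner V g f)"
  by (simp add: l2_inner_def mult.commute)

lemma l2_inner_sum_left:
  "l2_inner V (\<lambda>v. \<Sum>i\<in>I. x i * e i v) g = (\<Sum>i\<in>I. x i * l2_inner V (e i) g)"
proof -
  have "l2_inner V (\<lambda>v. \<Sum>i\<in>I. x i * e i v) g = (\<Sum>v\<in>V. \<Sum>i\<in>I. x i * (e i v * cnj (g v)))"
    by (simp add: l2_inner_def sum_distrib_right mult.assoc)
  also have "\<dots> = (\<Sum>i\<in>I. \<Sum>v\<in>V. x i * (e i v * cnj (g v)))"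
    by (rule sum.swap)
  finally show ?thesis
    by (simp add: l2_inner_def sum_distrib_left)
qed

lemma l2_inner_scale_left: "l2_inner V (\<lambda>v. a * f v) g = a * l2_inner V f g"
  by (simp add: l2_inner_def sum_distrib_left mult.assoc)

lemma l2_inner_scale_right: "l2_inner V f (\<lambda>v. a * g v) = cnj a * l2_inner V f g"
  by (simp add: l2_inner_def sum_distrib_left mult.left_commute)

lemma l2_inner_delta:
  assumes "finite V" "w \<in> V"
  shows "l2_inner V f (\<lambda>v. if v = w then 1 else 0) = f w"
  using assms by (simp add: l2_inner_def if_distrib[of "\<lambda>x. _ * cnj x"] sum.delta' cong: if_cong)

lemma l2_sum: "(\<And>i. i \<in> I \<Longrightarrow> e i \<in> l2 V) \<Longrightarrow> (\<lambda>v. \<Sum>i\<in>I. x i * e i v) \<in> l2 V"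
  by (auto simp: l2_def intro!: sum.neutral)

lemma l2_eqI:
  assumes "finite V" "f \<in> l2 V" "g \<in> l2 V"
    and "\<And>h. h \<in> l2 V \<Longrightarrow> l2_inner V f h = l2_inner V g h"
  shows "f = g"
proof
  fix w
  show "f w = g w"
  proof (cases "w \<in> V")
    case True
    then have "(\<lambda>v. if v = w then 1 else 0) \<in> l2 V"
      by (auto simp: l2_def)
    from assms(4)[OF this] True assms(1) show ?thesis
      by (simp add: l2_inner_delta)
  qed (use assms(2,3) in \<open>auto simp: l2_def\<close>)
qed

lemma l2_operator_linear:
  "l2_operator V T \<Longrightarrow> f \<in> l2 V \<Longrightarrow> g \<in> l2 V \<Longrightarrow>
    T (\<lambda>v. a * f v + b * g v) = (\<lambda>v. a * T f v + b * T g v)"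
  by (simp add: l2_operator_def)

lemma l2_operator_sum:
  assumes "l2_operator V T" "finite I" "\<And>i. i \<in> I \<Longrightarrow> e i \<in> l2 V"
  shows "T (\<lambda>v. \<Sum>i\<in>I. x i * e i v) = (\<lambda>v. \<Sum>i\<in>I. x i * T (e i) v)"
  using assms(2,3)
proof (induction I)
  case empty
  show ?case
    using l2_operator_linear[OF assms(1), of "\<lambda>v. 0" "\<lambda>v. 0" 0 0] by (simp add: l2_def)
next
  case (insert i I)
  have "(\<lambda>v. \<Sum>i\<in>I. x i * e i v) \<in> l2 V"
    using insert.prems by (intro l2_sum) auto
  moreover have "e i \<in> l2 V"
    using insert.prems by simp
  ultimately have "T (\<lambda>v. x i * e i v + 1 * (\<Sum>i\<in>I. x i * e i v)) =
      (\<lambda>v. x i * T (e i) v + 1 * T (\<lambda>v. \<Sum>i\<in>I. x i * e i v) v)"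
    by (intro l2_operator_linear[OF assms(1)])
  with insert show ?case by simp
qed

lemma conjugation_mem: "conjugation V C \<Longrightarrow> f \<in> l2 V \<Longrightarrow> C f \<in> l2 V"
  by (auto simp: conjugation_def)

lemma conjugation_conjugation: "conjugation V C \<Longrightarrow> f \<in> l2 V \<Longrightarrow> C (C f) = f"
  by (auto simp: conjugation_def)

lemma conjugation_inner:
  "conjugation V C \<Longrightarrow> f \<in> l2 V \<Longrightarrow> g \<in> l2 V \<Longrightarrow> l2_inner V (C f) (C g) = l2_inner V g f"
  by (auto simp: conjugation_def)

text \<open>
  A conjugation turns the inner product into the symmetric bilinear form \<open>\<langle>f, C g\<rangle>\<close>.
\<close>

lemma conjugation_bilinear_commute:
  assumes "conjugation V C" "f \<in> l2 V" "g \<in> l2 V"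
  shows "l2_inner V f (C g) = l2_inner V g (C f)"
  using conjugation_inner[OF assms(1) conjugation_mem[OF assms(1,3)] assms(2)]
  by (simp add: conjugation_conjugation[OF assms(1,3)])

text \<open>
  Complex symmetry is symmetry with respect to this bilinear form.  In this shape the adjoint has
  disappeared, so all later arguments compare matrix entries only.
\<close>

lemma C_symmetric_iff_bilinear:
  assumes "finite V" "conjugation V C" "l2_operator V T"
  shows "C_symmetric V C T \<longleftrightarrow>
    (\<forall>f\<in>l2 V. \<forall>g\<in>l2 V. l2_inner V (T f) (C g) = l2_inner V (T g) (C f))"
proof -
  note mem = conjugation_mem[OF assms(2)]
  have T_mem: "T f \<in> l2 V" if "f \<in> l2 V" for f
    using assms(3) that by (auto simp: l2_operator_def)
  have adjoint: "l2_adjoint V T g \<in> l2 V"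
    "f \<in> l2 V \<Longrightarrow> l2_inner V f (l2_adjoint V T g) = l2_inner V (T f) g" for f g
    using theI'[OF ex1_l2_adjoint[OF assms(1,3), of g]] unfolding l2_adjoint_def by auto
  have key: "l2_inner V (C (l2_adjoint V T (C f))) (C g) = l2_inner V (T g) (C f)"
    if "f \<in> l2 V" "g \<in> l2 V" for f g
    using conjugation_inner[OF assms(2) adjoint(1) that(2)] adjoint(2)[OF that(2)] by simp
  show ?thesis
  proof
    assume "C_symmetric V C T"
    then have "T f = C (l2_adjoint V T (C f))" if "f \<in> l2 V" for f
      using that by (simp add: C_symmetric_def)
    then show "\<forall>f\<in>l2 V. \<forall>g\<in>l2 V. l2_inner V (T f) (C g) = l2_inner V (T g) (C f)"
      using key by metis
  next
    assume sym: "\<forall>f\<in>l2 V. \<forall>g\<in>l2 V. l2_inner V (T f) (C g) = l2_inner V (T g) (C f)"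
    have "T f = C (l2_adjoint V T (C f))" if f: "f \<in> l2 V" for f
    proof (rule l2_eqI[OF assms(1) T_mem[OF f] mem[OF adjoint(1)]])
      fix h assume h: "h \<in> l2 V"
      then have "l2_inner V (T f) (C (C h)) = l2_inner V (C (l2_adjoint V T (C f))) (C (C h))"
        using sym f key[OF f mem[OF h]] mem by simp
      then show "l2_inner V (T f) h = l2_inner V (C (l2_adjoint V T (C f))) h"
        using conjugation_conjugation[OF assms(2) h] by simp
    qed
    with assms(3) show "C_symmetric V C T"
      by (simp add: C_symmetric_def)
  qed
qed

section \<open>Orthonormal bases\<close>

locale orthonormal_basis =
  fixes V :: "'v set" and I :: "'i set" and e :: "'i \<Rightarrow> 'v \<Rightarrow> complex"
  assumes finite_V: "finite V"
    and finite_I: "finite I"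
    and basis_mem: "i \<in> I \<Longrightarrow> e i \<in> l2 V"
    and orthonormal: "i \<in> I \<Longrightarrow> k \<in> I \<Longrightarrow> l2_inner V (e i) (e k) = (if i = k then 1 else 0)"
    and total: "f \<in> l2 V \<Longrightarrow> (\<And>i. i \<in> I \<Longrightarrow> l2_inner V f (e i) = 0) \<Longrightarrow> f = (\<lambda>v. 0)"
begin

lemma inner_expansion:
  assumes "k \<in> I"
  shows "l2_inner V (\<lambda>v. \<Sum>i\<in>I. x i * e i v) (e k) = x k"
proof -
  have "l2_inner V (\<lambda>v. \<Sum>i\<in>I. x i * e i v) (e k) = (\<Sum>i\<in>I. if i = k then x i else 0)"
    unfolding l2_inner_sum_left using assms by (intro sum.cong) (auto simp: orthonormal)
  with assms finite_I show ?thesis by simp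
qed

lemma coordinates_eqI:
  assumes "f \<in> l2 V" "g \<in> l2 V" "\<And>i. i \<in> I \<Longrightarrow> l2_inner V f (e i) = l2_inner V g (e i)"
  shows "f = g"
proof -
  have "l2_inner V (\<lambda>v. f v - g v) (e i) = l2_inner V f (e i) - l2_inner V g (e i)" for i
    by (simp add: l2_inner_def left_diff_distrib sum_subtractf)
  with assms have "(\<lambda>v. f v - g v) = (\<lambda>v. 0)"
    by (intro total) (auto simp: l2_def)
  then show ?thesis
    by (simp add: fun_eq_iff)
qed

lemma expansion:
  assumes "f \<in> l2 V"
  shows "f = (\<lambda>v. \<Sum>i\<in>I. l2_inner V f (e i) * e i v)"
  by (rule coordinates_eqI) (use assms in \<open>auto simp: inner_expansion intro!: l2_sum basis_mem\<close>)

lemma parseval: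
  assumes "f \<in> l2 V"
  shows "l2_inner V f g = (\<Sum>i\<in>I. l2_inner V f (e i) * cnj (l2_inner V g (e i)))"
  by (subst expansion[OF assms])
    (simp add: l2_inner_sum_left l2_inner_commute[of V _ g])

lemma C_symmetric_if_basis:
  assumes "conjugation V C" "l2_operator V T"
    and sym: "\<And>i k. i \<in> I \<Longrightarrow> k \<in> I \<Longrightarrow> l2_inner V (T (e i)) (C (e k)) = l2_inner V (T (e k)) (C (e i))"
  shows "C_symmetric V C T"
proof -
  have T_mem: "T f \<in> l2 V" if "f \<in> l2 V" for f
    using assms(2) that by (auto simp: l2_operator_def)
  have expand: "l2_inner V (T f) (C g) = (\<Sum>i\<in>I. l2_inner V f (e i) * l2_inner V (T (e i)) (C g))"
    if "f \<in> l2 V" for f g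
    by (subst expansion[OF that])
      (simp add: l2_operator_sum[OF assms(2) finite_I basis_mem] l2_inner_sum_left)
  have half: "l2_inner V (T (e i)) (C g) = l2_inner V (T g) (C (e i))" if "i \<in> I" "g \<in> l2 V" for i g
  proof -
    have "l2_inner V (T (e i)) (C g) = l2_inner V g (C (T (e i)))"
      using conjugation_bilinear_commute[OF assms(1) T_mem] basis_mem that by blast
    also have "\<dots> = (\<Sum>k\<in>I. l2_inner V g (e k) * l2_inner V (e k) (C (T (e i))))"
      by (subst expansion[OF that(2)]) (rule l2_inner_sum_left)
    also have "\<dots> = (\<Sum>k\<in>I. l2_inner V g (e k) * l2_inner V (T (e k)) (C (e i)))"
      using conjugation_bilinear_commute[OF assms(1) _ T_mem] basis_mem that sym
      by (intro sum.cong) auto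
    finally show ?thesis
      by (simp add: expand[OF that(2)])
  qed
  have "l2_inner V (T f) (C g) = l2_inner V (T g) (C f)" if "f \<in> l2 V" "g \<in> l2 V" for f g
  proof -
    have "l2_inner V (T f) (C g) = (\<Sum>i\<in>I. l2_inner V f (e i) * l2_inner V (e i) (C (T g)))"
      using conjugation_bilinear_commute[OF assms(1) _ T_mem] basis_mem that
      by (subst expand[OF that(1)], intro sum.cong) (auto simp: half)
    also have "\<dots> = l2_inner V f (C (T g))"
      by (subst (2) expansion[OF that(1)]) (rule l2_inner_sum_left[symmetric])
    finally show ?thesis
      using conjugation_bilinear_commute[OF assms(1) that(1) T_mem[OF that(2)]] by simp
  qed
  with C_symmetric_iff_bilinear[OF finite_V assms(1,2)] show ?thesis by blast
qed

text \<open>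
  This is the antilinear map with \<open>e i \<mapsto> \<gamma> (\<sigma> i) * e (\<sigma> i)\<close>, if \<open>\<sigma>\<close> is an involution of the
  index set.
\<close>

definition basis_conjugation :: "('i \<Rightarrow> 'i) \<Rightarrow> ('i \<Rightarrow> complex) \<Rightarrow> ('v \<Rightarrow> complex) \<Rightarrow> 'v \<Rightarrow> complex"
  where "basis_conjugation \<sigma> \<gamma> f = (\<lambda>v. \<Sum>i\<in>I. \<gamma> i * cnj (l2_inner V f (e (\<sigma> i))) * e i v)"

lemma conjugation_basis_conjugation:
  assumes \<sigma>: "\<And>i. i \<in> I \<Longrightarrow> \<sigma> i \<in> I" "\<And>i. i \<in> I \<Longrightarrow> \<sigma> (\<sigma> i) = i"
    and \<gamma>: "\<And>i. i \<in> I \<Longrightarrow> cmod (\<gamma> i) = 1" "\<And>i. i \<in> I \<Longrightarrow> \<gamma> (\<sigma> i) = \<gamma> i"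
  shows "conjugation V (basis_conjugation \<sigma> \<gamma>)"
proof -
  let ?C = "basis_conjugation \<sigma> \<gamma>"
  have mem: "?C f \<in> l2 V" for f
    unfolding basis_conjugation_def by (intro l2_sum basis_mem)
  have coord: "l2_inner V (?C f) (e i) = \<gamma> i * cnj (l2_inner V f (e (\<sigma> i)))" if "i \<in> I" for f i
    unfolding basis_conjugation_def by (rule inner_expansion[OF that])
  have unit: "\<gamma> i * cnj (\<gamma> i) = 1" if "i \<in> I" for i
    using \<gamma>(1)[OF that] by (simp add: complex_norm_square[symmetric])
  have "?C (\<lambda>v. a * f v + b * g v) = (\<lambda>v. cnj a * ?C f v + cnj b * ?C g v)" for f g a b
  proof -
    have "l2_inner V (\<lambda>v. a * f v + b * g v) h = a * l2_inner V f h + b * l2_inner V g h" for h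
      by (simp add: l2_inner_def distrib_right sum.distrib sum_distrib_left mult.assoc)
    then show ?thesis
      by (simp add: basis_conjugation_def fun_eq_iff sum_distrib_left sum.distrib[symmetric] algebra_simps)
  qed
  moreover have "?C (?C f) = f" if "f \<in> l2 V" for f
    using unit by (intro coordinates_eqI mem that) (auto simp: coord \<sigma> \<gamma> mult.assoc[symmetric])
  moreover have "l2_inner V (?C f) (?C g) = l2_inner V g f" if "g \<in> l2 V" for f g
  proof -
    have "l2_inner V (?C f) (?C g)
        = (\<Sum>i\<in>I. l2_inner V g (e (\<sigma> i)) * cnj (l2_inner V f (e (\<sigma> i))))"
    proof (subst parseval[OF mem], rule sum.cong)
      fix i assume "i \<in> I"
      then show "l2_inner V (?C f) (e i) * cnj (l2_inner V (?C g) (e i))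
          = l2_inner V g (e (\<sigma> i)) * cnj (l2_inner V f (e (\<sigma> i)))"
        using unit[of i] by (simp add: coord)
    qed simp
    also have "\<dots> = (\<Sum>i\<in>I. l2_inner V g (e i) * cnj (l2_inner V f (e i)))"
      by (rule sum.reindex_bij_witness[of _ \<sigma> \<sigma>]) (auto simp: \<sigma>)
    finally show ?thesis
      by (simp only: parseval[OF that, symmetric])
  qed
  ultimately show ?thesis
    using mem by (auto simp: conjugation_def)
qed

lemma basis_conjugation_basis:
  assumes "k \<in> I" "\<And>i. i \<in> I \<Longrightarrow> \<sigma> i \<in> I" "\<And>i. i \<in> I \<Longrightarrow> \<sigma> (\<sigma> i) = i"
  shows "basis_conjugation \<sigma> \<gamma> (e k) = (\<lambda>v. \<gamma> (\<sigma> k) * e (\<sigma> k) v)"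
proof
  fix v
  have "basis_conjugation \<sigma> \<gamma> (e k) v = (\<Sum>i\<in>I. if i = \<sigma> k then \<gamma> i * e i v else 0)"
    unfolding basis_conjugation_def
    using assms by (intro sum.cong) (auto simp: orthonormal)
  with assms finite_I show "basis_conjugation \<sigma> \<gamma> (e k) v = \<gamma> (\<sigma> k) * e (\<sigma> k) v"
    by simp
qed

text \<open>
  The matrix of the bilinear form of a conjugation is unitary; what is needed of this is that its
  rows are unit vectors.
\<close>

lemma conjugation_row_norm:
  assumes "conjugation V C" "i \<in> I"
  shows "(\<Sum>k\<in>I. (cmod (l2_inner V (e i) (C (e k))))\<^sup>2) = 1"
proof -
  have mem: "C (e i) \<in> l2 V"
    using assms basis_mem conjugation_mem by blast
  have "cmod (l2_inner V (e i) (C (e k))) = cmod (l2_inner V (C (e i)) (e k))" if "k \<in> I" for k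
    using conjugation_bilinear_commute[OF assms(1) basis_mem basis_mem, OF assms(2) that]
    by (subst (2) l2_inner_commute) simp
  then have "complex_of_real (\<Sum>k\<in>I. (cmod (l2_inner V (e i) (C (e k))))\<^sup>2)
      = (\<Sum>k\<in>I. complex_of_real ((cmod (l2_inner V (C (e i)) (e k)))\<^sup>2))"
    by simp
  also have "\<dots> = l2_inner V (C (e i)) (C (e i))"
    by (subst parseval[OF mem]) (simp only: complex_norm_square)
  also have "\<dots> = 1"
    using conjugation_inner[OF assms(1)] basis_mem[OF assms(2)] orthonormal assms(2) by simp
  finally show ?thesis
    by (simp only: of_real_eq_1_iff)
qed

end
section \<open>Direct sums of truncated weighted shifts\<close>

text \<open>
  The basis is a disjoint union of chains: chain \<open>c\<close> is
  \<open>e (c, 0), \<dots>, e (c, L c)\<close>, so \<open>L c\<close> counts its arrows, not its vectors, and \<open>T\<close> moves each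
  vector one step along its chain with the nonzero factor \<open>w c j\<close>.
\<close>

locale shift_sum =
  orthonormal_basis V "SIGMA c:UNIV. {..L c}" e
  for V :: "'v set" and L :: "'c::finite \<Rightarrow> nat" and e :: "'c \<times> nat \<Rightarrow> 'v \<Rightarrow> complex" +
  fixes T :: "('v \<Rightarrow> complex) \<Rightarrow> 'v \<Rightarrow> complex" and w :: "'c \<Rightarrow> nat \<Rightarrow> complex"
  assumes operator: "l2_operator V T"
    and weight_nonzero: "j < L c \<Longrightarrow> w c j \<noteq> 0"
    and shift: "j < L c \<Longrightarrow> T (e (c, j)) = (\<lambda>v. w c j * e (c, Suc j) v)"
    and shift_last: "T (e (c, L c)) = (\<lambda>v. 0)"
begin

text \<open>
  The matrix \<open>B\<close> of the bilinear form \<open>\<langle>f, C g\<rangle>\<close> is symmetric and unitary, and \<open>T\<close> may be moved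
  from one argument to the other.  Moving powers of \<open>T\<close> shows that the last vector of a longest
  chain pairs only with the first one, since \<open>T\<close> raised to the chain length kills every other
  basis vector.  Unitarity then forces the first vector to pair only with the last one, and moving powers
  of \<open>T\<close> again shows that \<open>C\<close> reverses the whole chain.  By symmetry this also settles
  the columns of that chain in \<open>B\<close>, so the argument continues with the next shorter one.
  Distinct lengths are what allows a single chain to be split off at a time.  Once all chains are known to be reversed, moving a
  single \<open>T\<close> compares each weight with its mirror image.
\<close>

lemma palindromic_if_complex_symmetric:
  assumes "complex_symmetric V T" and "inj L" and "j < L c"
  shows "cmod (w c j) = cmod (w c (L c - 1 - j))"
proof -
  from assms(1) obtain C where C: "conjugation V C" "C_symmetric V C T"
    by (auto simp: complex_symmetric_def)
  define B where "B i k = l2_inner V (e i) (C (e k))" for i k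
  have commute: "B (c, j) (d, k) = B (d, k) (c, j)" if "j \<le> L c" "k \<le> L d" for c d j k
    unfolding B_def using that by (intro conjugation_bilinear_commute[OF C(1)] basis_mem) auto
  have B_shift: "w c j * B (c, Suc j) (d, k) = (if k < L d then w d k * B (c, j) (d, Suc k) else 0)"
    if "j < L c" "k \<le> L d" for c d j k
  proof -
    have "w c j * B (c, Suc j) (d, k) = l2_inner V (T (e (c, j))) (C (e (d, k)))"
      by (simp add: B_def shift[OF that(1)] l2_inner_scale_left)
    also have "\<dots> = l2_inner V (T (e (d, k))) (C (e (c, j)))"
      using C_symmetric_iff_bilinear[OF finite_V C(1) operator] C(2) that basis_mem by simp
    also have "\<dots> = (if k < L d then w d k * B (d, Suc k) (c, j) else 0)"
    proof (cases "k < L d")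
      case True
      then show ?thesis by (simp add: B_def shift l2_inner_scale_left)
    next
      case False
      with that have "k = L d" by simp
      then show ?thesis by (simp add: shift_last l2_inner_def)
    qed
    finally show ?thesis
      using that by (auto simp: commute[of "Suc k" d j c])
  qed
  \<comment> \<open>Moving \<open>T\<close> to the power \<open>j\<close> across: row \<open>(c, j)\<close> is a shifted and rescaled row \<open>(c, 0)\<close>.\<close>
  have B_zero: "B (c, j) (d, k) = 0"
    if "j \<le> L c" "k \<le> L d" "j + k \<le> L d \<Longrightarrow> B (c, 0) (d, j + k) = 0" for c d j k
    using that
  proof (induction j arbitrary: k)
    case (Suc j)
    then have "w c j * B (c, Suc j) (d, k) = 0"
      by (auto simp: B_shift)
    with Suc.prems weight_nonzero[of j c] show ?case by simp
  qed simp
  have split: "(cmod (B i k))\<^sup>2 + (\<Sum>m\<in>(SIGMA c:UNIV. {..L c}) - {k}. (cmod (B i m))\<^sup>2) = 1"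
    if "i \<in> (SIGMA c:UNIV. {..L c})" "k \<in> (SIGMA c:UNIV. {..L c})" for i k
    using conjugation_row_norm[OF C(1) that(1)] unfolding B_def
    by (subst (asm) sum.remove[OF finite_I that(2)])
  \<comment> \<open>In a row of norm one, an entry is unimodular if and only if all others vanish; the next two
    facts are the two directions.\<close>
  have single: "cmod (B (c, j) (d, k)) = 1"
    if "j \<le> L c" "k \<le> L d" "\<And>c' m. m \<le> L c' \<Longrightarrow> (c', m) \<noteq> (d, k) \<Longrightarrow> B (c, j) (c', m) = 0"
    for c j d k
  proof -
    have "(\<Sum>m\<in>(SIGMA c:UNIV. {..L c}) - {(d, k)}. (cmod (B (c, j) m))\<^sup>2) = 0"
      using that(3) by (intro sum.neutral) auto
    with split[of "(c, j)" "(d, k)"] that(1,2) have "(cmod (B (c, j) (d, k)))\<^sup>2 = 1\<^sup>2"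
      by simp
    then show ?thesis
      by (rule power2_eq_imp_eq) auto
  qed
  have others: "B (c, j) (d, k) = 0"
    if "j \<le> L c" "k \<le> L d" "cmod (B (c, j) (c', k')) = 1" "k' \<le> L c'" "(d, k) \<noteq> (c', k')"
    for c j d k c' k'
  proof -
    have "(\<Sum>m\<in>(SIGMA c:UNIV. {..L c}) - {(c', k')}. (cmod (B (c, j) m))\<^sup>2) = 0"
      using split[of "(c, j)" "(c', k')"] that by simp
    then have "\<forall>m\<in>(SIGMA c:UNIV. {..L c}) - {(c', k')}. (cmod (B (c, j) m))\<^sup>2 = 0"
      using finite_I by (subst (asm) sum_nonneg_eq_0_iff) auto
    with that show ?thesis by auto
  qed
  have reflect: "B (c, j) (d, k) = 0" if "j \<le> L c" "k \<le> L d" "(d, k) \<noteq> (c, L c - j)" for c d j k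
    using that
  proof (induction c arbitrary: j d k rule: measure_induct_rule[where f = "\<lambda>c. Max (range L) - L c"])
    case (less c)
    \<comment> \<open>Longer chains are covered by the induction hypothesis, through the symmetry of \<open>B\<close>; on the
      others, \<open>T\<close> to the power \<open>L c\<close> vanishes except at \<open>(c, 0)\<close>.\<close>
    have last: "B (c, L c) (d, k) = 0" if "k \<le> L d" "(d, k) \<noteq> (c, 0)" for d k
    proof (cases "L c < L d")
      case True
      have "L d \<le> Max (range L)"
        by simp
      with True have "Max (range L) - L d < Max (range L) - L c"
        by linarith
      then have "B (d, k) (c, L c) = 0"
        using less.IH[of d k "L c" c] that True by auto
      then show ?thesis
        using commute that by simp
    next
      case False
      then have "\<not> L c + k \<le> L d"
        using that assms(2) by (auto simp: inj_def)
      then show ?thesis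
        using that by - (rule B_zero, auto)
    qed
    then have "cmod (B (c, 0) (c, L c)) = 1"
      using single[of "L c" c 0 c] commute[of 0 c "L c" c] by simp
    then have first: "B (c, 0) (d, k) = 0" if "k \<le> L d" "(d, k) \<noteq> (c, L c)" for d k
      using others[of 0 c k d c "L c"] that by simp
    show ?case
      using less.prems by - (rule B_zero, auto intro!: first)
  qed
  have unit: "cmod (B (c, j) (c, L c - j)) = 1" if "j \<le> L c" for j
    using that reflect by (intro single) auto
  have "w c j * B (c, Suc j) (c, L c - Suc j) = w c (L c - Suc j) * B (c, j) (c, L c - j)"
    using B_shift[OF assms(3), of "L c - Suc j" c] assms(3) by (simp add: Suc_diff_Suc)
  then have "cmod (w c j * B (c, Suc j) (c, L c - Suc j)) = cmod (w c (L c - Suc j) * B (c, j) (c, L c - j))"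
    by simp
  then show ?thesis
    using unit[of j] unit[of "Suc j"] assms(3) by (simp add: norm_mult)
qed

text \<open>
  A conjugation \<open>C\<close> that reverses every chain makes \<open>T\<close> \<open>C\<close>-symmetric if its factors satisfy
  the recursion \<open>\<gamma>_Suc\<close> below.  The solution in terms of the partial products \<open>p\<close> of the weights
  is visibly invariant under reversal, which makes the map an involution; the palindrome condition
  makes its factors unimodular.
\<close>

lemma complex_symmetric_if_palindromic:
  assumes palindromic: "\<And>c j. j < L c \<Longrightarrow> cmod (w c j) = cmod (w c (L c - 1 - j))"
  shows "complex_symmetric V T"
proof -
  define p where "p c j = (\<Prod>i<j. w c i)" for c j
  define \<sigma> where "\<sigma> = (\<lambda>(c, j). (c, L c - j))"
  define \<gamma> where "\<gamma> = (\<lambda>(c, j). cnj (p c (L c) / (p c j * p c (L c - j))))"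
  have p_nonzero: "p c j \<noteq> 0" if "j \<le> L c" for c j
    unfolding p_def using that weight_nonzero by auto
  have \<gamma>_Suc: "w c j * cnj (\<gamma> (c, Suc j)) = w c (L c - Suc j) * cnj (\<gamma> (c, j))" if "j < L c" for c j
  proof -
    have "L c - j = Suc (L c - Suc j)"
      using that by simp
    then have "p c (Suc j) = p c j * w c j" "p c (L c - j) = p c (L c - Suc j) * w c (L c - Suc j)"
      by (simp_all add: p_def)
    with that show ?thesis
      using p_nonzero[of j c] p_nonzero[of "L c - Suc j" c] weight_nonzero[of j c]
        weight_nonzero[of "L c - Suc j" c]
      by (simp add: \<gamma>_def field_simps)
  qed
  have \<gamma>_unit: "cmod (\<gamma> (c, j)) = 1" if "j \<le> L c" for c j
    using that
  proof (induction j)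
    case 0
    then show ?case
      using p_nonzero[of "L c" c] by (simp add: \<gamma>_def p_def)
  next
    case (Suc j)
    then have "cmod (w c j * cnj (\<gamma> (c, Suc j))) = cmod (w c j) * 1"
      using palindromic[of j c] by (simp add: \<gamma>_Suc norm_mult)
    with Suc.prems weight_nonzero[of j c] show ?case
      by (simp add: norm_mult)
  qed
  have \<sigma>: "\<sigma> i \<in> (SIGMA c:UNIV. {..L c})" "\<sigma> (\<sigma> i) = i" and \<gamma>: "\<gamma> (\<sigma> i) = \<gamma> i"
    if "i \<in> (SIGMA c:UNIV. {..L c})" for i
    using that by (auto simp: \<sigma>_def \<gamma>_def mult.commute)
  let ?C = "basis_conjugation \<sigma> \<gamma>"
  have conj: "conjugation V ?C"
    using \<sigma> \<gamma> \<gamma>_unit by (intro conjugation_basis_conjugation) auto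
  have entry: "l2_inner V (T (e (c, j))) (?C (e (d, k)))
      = (if j < L c \<and> d = c \<and> Suc (j + k) = L c then w c j * cnj (\<gamma> (c, Suc j)) else 0)"
    if "j \<le> L c" "k \<le> L d" for c d j k
  proof (cases "j < L c")
    case True
    have "?C (e (d, k)) = (\<lambda>v. \<gamma> (d, L d - k) * e (d, L d - k) v)"
      using basis_conjugation_basis[of "(d, k)" \<sigma> \<gamma>] \<sigma> that by (simp add: \<sigma>_def)
    with True that show ?thesis
      by (auto simp: shift l2_inner_scale_left l2_inner_scale_right orthonormal)
  next
    case False
    with that have "j = L c" by simp
    then show ?thesis by (simp add: shift_last l2_inner_def)
  qed
  have "C_symmetric V ?C T"
  proof (rule C_symmetric_if_basis[OF conj operator])
    fix i k assume ik: "i \<in> (SIGMA c:UNIV. {..L c})" "k \<in> (SIGMA c:UNIV. {..L c})"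
    obtain c j d m where [simp]: "i = (c, j)" "k = (d, m)"
      by (cases i, cases k)
    have "w c j * cnj (\<gamma> (c, Suc j)) = w c m * cnj (\<gamma> (c, Suc m))" if "Suc (j + m) = L c"
    proof -
      have "L c - Suc j = m" "\<sigma> (c, Suc m) = (c, j)"
        using that by (auto simp: \<sigma>_def)
      then show ?thesis
        using \<gamma>_Suc[of j c] \<gamma>[of "(c, Suc m)"] that by simp
    qed
    then show "l2_inner V (T (e i)) (?C (e k)) = l2_inner V (T (e k)) (?C (e i))"
      using ik by (auto simp: entry add.commute)
  qed
  with conj show ?thesis
    by (auto simp: complex_symmetric_def)
qed

lemma complex_symmetric_iff_palindromic:
  assumes "inj L"
  shows "complex_symmetric V T \<longleftrightarrow> (\<forall>c. \<forall>j<L c. cmod (w c j) = cmod (w c (L c - 1 - j)))"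
  using palindromic_if_complex_symmetric[OF _ assms] complex_symmetric_if_palindromic by blast

end
section \<open>The two chains inside the tree\<close>

lemma Trunk_in_verts [simp]: "Trunk x \<in> verts \<kappa> \<theta> \<longleftrightarrow> - int \<kappa> \<le> x \<and> x \<le> 0"
proof
  assume "- int \<kappa> \<le> x \<and> x \<le> 0"
  then have "x = 0 \<or> x = - int (nat (- x)) \<and> nat (- x) \<in> {1..\<kappa>}"
    by auto
  then show "Trunk x \<in> verts \<kappa> \<theta>"
    by (auto simp: verts_def)
qed (auto simp: verts_def)

lemma Branch_in_verts [simp]: "Branch i j \<in> verts \<kappa> \<theta> \<longleftrightarrow> i \<in> {1, 2} \<and> 1 \<le> j \<and> j \<le> \<theta>"
  by (auto simp: verts_def)

lemma nonroot_verts_iff [simp]: "v \<in> nonroot_verts \<kappa> \<theta> \<longleftrightarrow> v \<in> verts \<kappa> \<theta> \<and> v \<noteq> Trunk (- int \<kappa>)"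
  by (auto simp: nonroot_verts_def root_vertex_def)

lemma parent_eqI: "v \<in> nonroot_verts \<kappa> \<theta> \<Longrightarrow> (u, v) \<in> edges \<kappa> \<theta> \<Longrightarrow> parent \<kappa> \<theta> v = u"
  unfolding parent_def by (rule the1_equality[OF ex1_parent])

lemma parent_Trunk:
  assumes "- int \<kappa> < x" "x \<le> 0"
  shows "parent \<kappa> \<theta> (Trunk x) = Trunk (x - 1)"
proof (rule parent_eqI)
  have "x - 1 = - int (nat (1 - x))" "x = - int (nat (1 - x)) + 1" "nat (1 - x) \<in> {1..\<kappa>}"
    using assms by auto
  then show "(Trunk (x - 1), Trunk x) \<in> edges \<kappa> \<theta>"
    unfolding edges_def by blast
qed (use assms in auto)

lemma parent_Branch:
  assumes "i \<in> {1, 2}" "j < \<theta>"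
  shows "parent \<kappa> \<theta> (Branch i (Suc j)) = (if j = 0 then Trunk 0 else Branch i j)"
proof (rule parent_eqI)
  show "(if j = 0 then Trunk 0 else Branch i j, Branch i (Suc j)) \<in> edges \<kappa> \<theta>"
    using assms by (auto simp: edges_def)
qed (use assms in auto)

definition delta :: "'v \<Rightarrow> 'v \<Rightarrow> complex" where
  "delta u = (\<lambda>v. if v = u then 1 else 0)"

text \<open>
  The index \<open>True\<close> names the chain of functions that are symmetric under exchanging the two
  branches; it runs from the root through the trunk and then along both branches at once.  The
  index \<open>False\<close> names the chain of antisymmetric functions, which live on the branches only.
\<close>

definition chain_length :: "nat \<Rightarrow> nat \<Rightarrow> bool \<Rightarrow> nat" where
  "chain_length \<kappa> \<theta> c = (if c then \<kappa> + \<theta> else \<theta> - 1)"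

fun chain_basis :: "nat \<Rightarrow> bool \<times> nat \<Rightarrow> vertex \<Rightarrow> complex" where
  "chain_basis \<kappa> (True, j) =
     (if j \<le> \<kappa> then delta (Trunk (int j - int \<kappa>))
      else (\<lambda>v. (delta (Branch 1 (j - \<kappa>)) v + delta (Branch 2 (j - \<kappa>)) v) / sqrt 2))"
| "chain_basis \<kappa> (False, j) =
     (\<lambda>v. (delta (Branch 1 (Suc j)) v - delta (Branch 2 (Suc j)) v) / sqrt 2)"

text \<open>
  On the symmetric chain one weight changes: the shift sends \<open>\<delta>\<^sub>0\<close> to
  \<open>\<lambda>\<^sub>1 (\<delta>\<^bsub>(1,1)\<^esub> + \<delta>\<^bsub>(2,1)\<^esub>)\<close>, a vector that has norm \<open>sqrt 2 * \<bar>\<lambda>\<^sub>1\<bar>\<close>.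
  The antisymmetric chain starts at level \<open>1\<close> of the branches, so its weights start with
  \<open>\<lambda>\<^sub>2\<close>, the weight of the step from level \<open>1\<close> to level \<open>2\<close>.
\<close>

definition chain_weight :: "nat \<Rightarrow> (vertex \<Rightarrow> complex) \<Rightarrow> bool \<Rightarrow> nat \<Rightarrow> complex" where
  "chain_weight \<kappa> lam c j =
     (if c then (if j = \<kappa> then sqrt 2 else 1) * weight_at lam (int j + 1 - int \<kappa>)
      else weight_at lam (int j + 2))"

lemma inner_delta: "finite V \<Longrightarrow> u \<in> V \<Longrightarrow> l2_inner V f (delta u) = f u"
  unfolding delta_def by (rule l2_inner_delta)

lemma inner_chain_basis_True:
  assumes "j \<le> \<kappa> + \<theta>"
  shows "l2_inner (verts \<kappa> \<theta>) f (chain_basis \<kappa> (True, j)) =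
    (if j \<le> \<kappa> then f (Trunk (int j - int \<kappa>))
     else (f (Branch 1 (j - \<kappa>)) + f (Branch 2 (j - \<kappa>))) / sqrt 2)"
proof (cases "j \<le> \<kappa>")
  case True
  then show ?thesis by (simp add: inner_delta finite_verts)
next
  case False
  then have "l2_inner (verts \<kappa> \<theta>) f (chain_basis \<kappa> (True, j)) =
      (l2_inner (verts \<kappa> \<theta>) f (delta (Branch 1 (j - \<kappa>)))
        + l2_inner (verts \<kappa> \<theta>) f (delta (Branch 2 (j - \<kappa>)))) / sqrt 2"
    by (simp add: l2_inner_def sum.distrib distrib_left add_divide_distrib sum_divide_distrib)
  moreover have "Branch 1 (j - \<kappa>) \<in> verts \<kappa> \<theta>" "Branch 2 (j - \<kappa>) \<in> verts \<kappa> \<theta>"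
    using False assms by auto
  ultimately show ?thesis
    using False by (simp only: inner_delta[OF finite_verts] if_False)
qed

lemma inner_chain_basis_False:
  assumes "j < \<theta>"
  shows "l2_inner (verts \<kappa> \<theta>) f (chain_basis \<kappa> (False, j)) =
    (f (Branch 1 (Suc j)) - f (Branch 2 (Suc j))) / sqrt 2"
proof -
  have "l2_inner (verts \<kappa> \<theta>) f (chain_basis \<kappa> (False, j)) =
      (l2_inner (verts \<kappa> \<theta>) f (delta (Branch 1 (Suc j)))
        - l2_inner (verts \<kappa> \<theta>) f (delta (Branch 2 (Suc j)))) / sqrt 2"
    by (simp add: l2_inner_def sum_subtractf right_diff_distrib diff_divide_distrib sum_divide_distrib)
  moreover have "Branch 1 (Suc j) \<in> verts \<kappa> \<theta>" "Branch 2 (Suc j) \<in> verts \<kappa> \<theta>"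
    using assms by auto
  ultimately show ?thesis
    by (simp only: inner_delta[OF finite_verts])
qed

lemma sqrt2_squared: "complex_of_real (sqrt 2) * complex_of_real (sqrt 2) = 2"
  by (simp flip: of_real_mult)

lemma two_div_sqrt2: "2 / complex_of_real (sqrt 2) = complex_of_real (sqrt 2)"
  by (simp add: divide_eq_eq sqrt2_squared)

lemma orthonormal_basis_chain_basis:
  assumes "1 \<le> \<theta>"
  shows "orthonormal_basis (verts \<kappa> \<theta>) (SIGMA c:UNIV. {..chain_length \<kappa> \<theta> c}) (chain_basis \<kappa>)"
proof
  let ?I = "SIGMA c:UNIV. {..chain_length \<kappa> \<theta> c}"
  show "chain_basis \<kappa> i \<in> l2 (verts \<kappa> \<theta>)" if "i \<in> ?I" for i
  proof -
    obtain c j where "i = (c, j)" by (cases i)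
    with that assms show ?thesis
      by (cases c) (auto simp: l2_def delta_def chain_length_def)
  qed
  show "l2_inner (verts \<kappa> \<theta>) (chain_basis \<kappa> i) (chain_basis \<kappa> k) = (if i = k then 1 else 0)"
    if "i \<in> ?I" "k \<in> ?I" for i k
  proof -
    obtain c j d m where "i = (c, j)" "k = (d, m)" by (cases i, cases k)
    with that assms show ?thesis
      by (cases c; cases d;
          simp add: chain_length_def inner_chain_basis_True inner_chain_basis_False del: chain_basis.simps)
        (auto simp: delta_def two_div_sqrt2)
  qed
  show "f = (\<lambda>v. 0)"
    if f: "f \<in> l2 (verts \<kappa> \<theta>)"
      and orth: "\<And>i. i \<in> ?I \<Longrightarrow> l2_inner (verts \<kappa> \<theta>) f (chain_basis \<kappa> i) = 0" for f
  proof
    fix v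
    show "f v = 0"
    proof (cases "v \<in> verts \<kappa> \<theta>")
      case in_V: True
      show ?thesis
      proof (cases v)
        case (Trunk x)
        with in_V have x: "nat (x + int \<kappa>) \<le> \<kappa>" "int (nat (x + int \<kappa>)) = x + int \<kappa>"
          by auto
        with orth[of "(True, nat (x + int \<kappa>))"] Trunk show ?thesis
          by (simp add: chain_length_def inner_chain_basis_True del: chain_basis.simps)
      next
        case (Branch i j)
        with in_V have "i \<in> {1, 2}" "1 \<le> j" "j \<le> \<theta>"
          by auto
        then have "f (Branch 1 j) + f (Branch 2 j) = 0" "f (Branch 1 j) - f (Branch 2 j) = 0"
          using orth[of "(True, \<kappa> + j)"] orth[of "(False, j - 1)"]
          by (auto simp: chain_length_def inner_chain_basis_True inner_chain_basis_False
              simp del: chain_basis.simps)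
        then have "f (Branch 1 j) = 0" "f (Branch 2 j) = 0"
          by auto
        with Branch \<open>i \<in> {1, 2}\<close> show ?thesis
          by auto
      qed
    qed (use f in \<open>auto simp: l2_def\<close>)
  qed
qed (auto simp: finite_verts)

lemma weighted_shift_chain_True:
  assumes "j < \<kappa> + \<theta>" "\<forall>j\<in>{1..\<theta>}. lam (Branch 1 j) = lam (Branch 2 j)"
  shows "weighted_shift \<kappa> \<theta> lam (chain_basis \<kappa> (True, j)) =
    (\<lambda>v. chain_weight \<kappa> lam True j * chain_basis \<kappa> (True, Suc j) v)"
proof
  fix v
  show "weighted_shift \<kappa> \<theta> lam (chain_basis \<kappa> (True, j)) v =
    chain_weight \<kappa> lam True j * chain_basis \<kappa> (True, Suc j) v"
  proof (cases v)
    case (Trunk x)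
    then show ?thesis
      by (auto simp: weighted_shift_def parent_Trunk delta_def chain_weight_def weight_at_def add.commute)
  next
    case (Branch i m)
    then show ?thesis
      using assms
      by (cases m) (auto simp: weighted_shift_def parent_Branch delta_def chain_weight_def
          weight_at_def nat_diff_distrib Suc_diff_le sqrt2_squared nat_add_distrib)
  qed
qed

lemma weighted_shift_chain_False:
  assumes "Suc j < \<theta>" "\<forall>j\<in>{1..\<theta>}. lam (Branch 1 j) = lam (Branch 2 j)"
  shows "weighted_shift \<kappa> \<theta> lam (chain_basis \<kappa> (False, j)) =
    (\<lambda>v. chain_weight \<kappa> lam False j * chain_basis \<kappa> (False, Suc j) v)"
proof
  fix v
  show "weighted_shift \<kappa> \<theta> lam (chain_basis \<kappa> (False, j)) v =
    chain_weight \<kappa> lam False j * chain_basis \<kappa> (False, Suc j) v"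
  proof (cases v)
    case (Trunk x)
    then show ?thesis
      by (auto simp: weighted_shift_def parent_Trunk delta_def)
  next
    case (Branch i m)
    have "nat (int j + 2) = Suc (Suc j)"
      by simp
    with Branch assms show ?thesis
      by (cases m) (auto simp: weighted_shift_def parent_Branch delta_def chain_weight_def weight_at_def)
  qed
qed

lemma weighted_shift_chain_last:
  assumes "1 \<le> \<theta>"
  shows "weighted_shift \<kappa> \<theta> lam (chain_basis \<kappa> (c, chain_length \<kappa> \<theta> c)) = (\<lambda>v. 0)"
proof
  fix v
  show "weighted_shift \<kappa> \<theta> lam (chain_basis \<kappa> (c, chain_length \<kappa> \<theta> c)) v = 0"
  proof (cases v)
    case (Trunk x)
    with assms show ?thesis
      by (cases c) (auto simp: weighted_shift_def parent_Trunk delta_def chain_length_def)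
  next
    case (Branch i m)
    with assms show ?thesis
      by (cases c; cases m)
        (auto simp: weighted_shift_def parent_Branch delta_def chain_length_def)
  qed
qed

lemma chain_weight_nonzero:
  assumes "\<forall>v\<in>nonroot_verts \<kappa> \<theta>. lam v \<noteq> 0" "j < chain_length \<kappa> \<theta> c"
  shows "chain_weight \<kappa> lam c j \<noteq> 0"
proof -
  have "weight_at lam x \<noteq> 0" if "- int \<kappa> < x" "x \<le> int \<theta>" for x
  proof (cases "x \<le> 0")
    case False
    then have "1 \<le> nat x" "nat x \<le> \<theta>"
      using that by auto
    with False assms(1) show ?thesis
      by (simp add: weight_at_def)
  qed (use assms(1) that in \<open>simp add: weight_at_def\<close>)
  with assms(2) show ?thesis
    by (auto simp: chain_weight_def chain_length_def split: if_splits)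
qed

lemma shift_sum_weighted_shift:
  assumes "1 \<le> \<theta>" "\<forall>v\<in>nonroot_verts \<kappa> \<theta>. lam v \<noteq> 0"
    and "\<forall>j\<in>{1..\<theta>}. lam (Branch 1 j) = lam (Branch 2 j)"
  shows "shift_sum (verts \<kappa> \<theta>) (chain_length \<kappa> \<theta>) (chain_basis \<kappa>)
    (weighted_shift \<kappa> \<theta> lam) (chain_weight \<kappa> lam)"
proof -
  interpret orthonormal_basis "verts \<kappa> \<theta>" "SIGMA c:UNIV. {..chain_length \<kappa> \<theta> c}" "chain_basis \<kappa>"
    using assms(1) by (rule orthonormal_basis_chain_basis)
  show ?thesis
  proof
    fix c j
    assume "j < chain_length \<kappa> \<theta> c"
    then show "weighted_shift \<kappa> \<theta> lam (chain_basis \<kappa> (c, j)) =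
        (\<lambda>v. chain_weight \<kappa> lam c j * chain_basis \<kappa> (c, Suc j) v)"
      using assms(3)
      by (cases c)
        (auto simp: chain_length_def weighted_shift_chain_True weighted_shift_chain_False
          simp del: chain_basis.simps)
  qed (use assms in \<open>auto simp: l2_operator_weighted_shift weighted_shift_chain_last chain_weight_nonzero
        simp del: chain_basis.simps nonroot_verts_iff\<close>)
qed

section \<open>The palindrome conditions in terms of the original weights\<close>

text \<open>
  The position \<open>\<kappa>\<close> of the scaled entry and the position \<open>\<theta> - 1\<close> are mirror images of
  each other.  If they coincide, the scaled entry is compared with itself and the scaling
  factor cancels; otherwise the factor survives in exactly one of the conditions.
\<close>

lemma palindrome_with_scaled_entry:
  fixes m :: "nat \<Rightarrow> real" and s :: real and \<kappa> \<theta> :: nat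
  assumes "1 \<le> \<theta>"
  defines "M \<equiv> \<lambda>j. (if j = \<kappa> then s else 1) * m j"
  shows "(\<forall>j<\<kappa> + \<theta>. M j = M (\<kappa> + \<theta> - 1 - j)) \<longleftrightarrow>
    (\<theta> = \<kappa> + 1 \<longrightarrow> (\<forall>j<\<kappa> + \<theta>. m j = m (\<kappa> + \<theta> - 1 - j))) \<and>
    (\<theta> \<noteq> \<kappa> + 1 \<longrightarrow> s * m \<kappa> = m (\<theta> - 1) \<and>
      (\<forall>j<\<kappa> + \<theta>. j \<noteq> \<kappa> \<and> j \<noteq> \<theta> - 1 \<longrightarrow> m j = m (\<kappa> + \<theta> - 1 - j)))"
proof (cases "\<theta> = \<kappa> + 1")
  case True
  then have "M j = M (\<kappa> + \<theta> - 1 - j) \<longleftrightarrow> m j = m (\<kappa> + \<theta> - 1 - j)" if "j < \<kappa> + \<theta>" for j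
    using that by (cases "j = \<kappa>") (auto simp: M_def)
  with True show ?thesis by auto
next
  case False
  have M: "M j = m j" if "j \<noteq> \<kappa>" for j
    using that by (simp add: M_def)
  have plain: "M j = M (\<kappa> + \<theta> - 1 - j) \<longleftrightarrow> m j = m (\<kappa> + \<theta> - 1 - j)"
    if "j < \<kappa> + \<theta>" "j \<noteq> \<kappa>" "j \<noteq> \<theta> - 1" for j
    using that by (subst (1 2) M) auto
  have "M \<kappa> = M (\<kappa> + \<theta> - 1 - \<kappa>) \<longleftrightarrow> s * m \<kappa> = m (\<theta> - 1)"
    "M (\<theta> - 1) = M (\<kappa> + \<theta> - 1 - (\<theta> - 1)) \<longleftrightarrow> s * m \<kappa> = m (\<theta> - 1)"
    using False assms(1) by (auto simp: M_def)
  note * = this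
  have "(\<forall>j<\<kappa> + \<theta>. M j = M (\<kappa> + \<theta> - 1 - j)) \<longleftrightarrow> s * m \<kappa> = m (\<theta> - 1) \<and>
      (\<forall>j<\<kappa> + \<theta>. j \<noteq> \<kappa> \<and> j \<noteq> \<theta> - 1 \<longrightarrow> M j = M (\<kappa> + \<theta> - 1 - j))"
  proof -
    have "\<kappa> < \<kappa> + \<theta>" "\<theta> - 1 < \<kappa> + \<theta>"
      using assms(1) by auto
    with * show ?thesis by blast
  qed
  with False plain show ?thesis by auto
qed

lemma ball_atLeast1_atMost_iff: "(\<forall>j\<in>{1..n}. P j) \<longleftrightarrow> (\<forall>j<n. P (Suc j))"
  by (subst image_Suc_lessThan[symmetric]) auto

theorem theorem3:
  fixes \<kappa> \<theta> :: nat and lam :: "vertex \<Rightarrow> complex"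
  assumes "1 \<le> \<theta>"
    and "\<forall>v\<in>nonroot_verts \<kappa> \<theta>. lam v \<noteq> 0"
    and "\<forall>j\<in>{1..\<theta>}. lam (Branch 1 j) = lam (Branch 2 j)"
  shows "complex_symmetric (verts \<kappa> \<theta>) (weighted_shift \<kappa> \<theta> lam) \<longleftrightarrow>
     (\<forall>j\<in>{1..\<theta> - 1}. cmod (weight_at lam (1 + int j)) = cmod (weight_at lam (int \<theta> + 1 - int j))) \<and>
     (int \<theta> - int \<kappa> = 1 \<longrightarrow>
        (\<forall>j\<in>{1..\<kappa> + \<theta>}.
           cmod (weight_at lam (- int \<kappa> + int j)) = cmod (weight_at lam (int \<theta> - int j + 1)))) \<and>
     (int \<theta> - int \<kappa> \<noteq> 1 \<longrightarrow>
        sqrt 2 * cmod (weight_at lam 1) = cmod (weight_at lam (int \<theta> - int \<kappa>)) \<and>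
        (\<forall>j\<in>{1..\<kappa> + \<theta>} - {\<kappa> + 1, \<theta>}.
           cmod (weight_at lam (- int \<kappa> + int j)) = cmod (weight_at lam (int \<theta> - int j + 1))))"
proof -
  interpret shift_sum "verts \<kappa> \<theta>" "chain_length \<kappa> \<theta>" "chain_basis \<kappa>"
    "weighted_shift \<kappa> \<theta> lam" "chain_weight \<kappa> lam"
    using assms by (rule shift_sum_weighted_shift)
  define m where "m j = cmod (weight_at lam (int j + 1 - int \<kappa>))" for j
  have mirror: "cmod (weight_at lam (- int \<kappa> + int (Suc j))) = m j"
    "cmod (weight_at lam (int \<theta> - int (Suc j) + 1)) = m (\<kappa> + \<theta> - 1 - j)" if "j < \<kappa> + \<theta>" for j
  proof -
    have "int (\<kappa> + \<theta> - 1 - j) + 1 - int \<kappa> = int \<theta> - int (Suc j) + 1"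
      "- int \<kappa> + int (Suc j) = int j + 1 - int \<kappa>"
      using that by auto
    then show "cmod (weight_at lam (- int \<kappa> + int (Suc j))) = m j"
      "cmod (weight_at lam (int \<theta> - int (Suc j) + 1)) = m (\<kappa> + \<theta> - 1 - j)"
      by (simp_all only: m_def)
  qed
  have middle: "cmod (weight_at lam 1) = m \<kappa>" "cmod (weight_at lam (int \<theta> - int \<kappa>)) = m (\<theta> - 1)"
    using assms(1) by (simp_all add: m_def of_nat_diff)
  have long: "(\<forall>j<chain_length \<kappa> \<theta> True. cmod (chain_weight \<kappa> lam True j)
        = cmod (chain_weight \<kappa> lam True (chain_length \<kappa> \<theta> True - 1 - j))) \<longleftrightarrow>
      (int \<theta> - int \<kappa> = 1 \<longrightarrow>
        (\<forall>j\<in>{1..\<kappa> + \<theta>}.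
           cmod (weight_at lam (- int \<kappa> + int j)) = cmod (weight_at lam (int \<theta> - int j + 1)))) \<and>
      (int \<theta> - int \<kappa> \<noteq> 1 \<longrightarrow>
        sqrt 2 * cmod (weight_at lam 1) = cmod (weight_at lam (int \<theta> - int \<kappa>)) \<and>
        (\<forall>j\<in>{1..\<kappa> + \<theta>} - {\<kappa> + 1, \<theta>}.
           cmod (weight_at lam (- int \<kappa> + int j)) = cmod (weight_at lam (int \<theta> - int j + 1))))"
  proof -
    have weight: "cmod (chain_weight \<kappa> lam True j) = (if j = \<kappa> then sqrt 2 else 1) * m j" for j
      by (simp add: chain_weight_def m_def norm_mult)
    have "int \<theta> - int \<kappa> = 1 \<longleftrightarrow> \<theta> = \<kappa> + 1"
      by auto
    moreover have "(\<forall>j\<in>{1..\<kappa> + \<theta>}.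
           cmod (weight_at lam (- int \<kappa> + int j)) = cmod (weight_at lam (int \<theta> - int j + 1)))
        \<longleftrightarrow> (\<forall>j<\<kappa> + \<theta>. m j = m (\<kappa> + \<theta> - 1 - j))"
      unfolding ball_atLeast1_atMost_iff using mirror by simp
    moreover have "(\<forall>j\<in>{1..\<kappa> + \<theta>} - {\<kappa> + 1, \<theta>}.
           cmod (weight_at lam (- int \<kappa> + int j)) = cmod (weight_at lam (int \<theta> - int j + 1)))
        \<longleftrightarrow> (\<forall>j\<in>{1..\<kappa> + \<theta>}. j \<noteq> \<kappa> + 1 \<and> j \<noteq> \<theta> \<longrightarrow>
           cmod (weight_at lam (- int \<kappa> + int j)) = cmod (weight_at lam (int \<theta> - int j + 1)))"
      by auto
    moreover have "\<dots>
        \<longleftrightarrow> (\<forall>j<\<kappa> + \<theta>. j \<noteq> \<kappa> \<and> j \<noteq> \<theta> - 1 \<longrightarrow> m j = m (\<kappa> + \<theta> - 1 - j))"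
    proof -
      have "Suc j \<noteq> \<theta> \<longleftrightarrow> j \<noteq> \<theta> - 1" for j
        using assms(1) by auto
      then show ?thesis
        unfolding ball_atLeast1_atMost_iff using mirror by simp
    qed
    ultimately show ?thesis
      using palindrome_with_scaled_entry[OF assms(1), of \<kappa> "sqrt 2" m]
      by (simp only: weight middle chain_length_def if_True)
  qed
  have short: "(\<forall>j<chain_length \<kappa> \<theta> False. cmod (chain_weight \<kappa> lam False j)
        = cmod (chain_weight \<kappa> lam False (chain_length \<kappa> \<theta> False - 1 - j))) \<longleftrightarrow>
      (\<forall>j\<in>{1..\<theta> - 1}. cmod (weight_at lam (1 + int j)) = cmod (weight_at lam (int \<theta> + 1 - int j)))"
  proof -
    have "chain_weight \<kappa> lam False j = weight_at lam (1 + int (Suc j))"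
      "chain_weight \<kappa> lam False (\<theta> - 1 - 1 - j) = weight_at lam (int \<theta> + 1 - int (Suc j))"
      if "j < \<theta> - 1" for j
    proof -
      have "int j + 2 = 1 + int (Suc j)" "int (\<theta> - 1 - 1 - j) + 2 = int \<theta> + 1 - int (Suc j)"
        using that by auto
      then show "chain_weight \<kappa> lam False j = weight_at lam (1 + int (Suc j))"
        "chain_weight \<kappa> lam False (\<theta> - 1 - 1 - j) = weight_at lam (int \<theta> + 1 - int (Suc j))"
        by (simp_all only: chain_weight_def if_False)
    qed
    then show ?thesis
      unfolding ball_atLeast1_atMost_iff chain_length_def if_False
      by (metis (no_types, lifting))
  qed
  have "inj (chain_length \<kappa> \<theta>)"
    using assms(1) by (auto simp: inj_def chain_length_def)
  from complex_symmetric_iff_palindromic[OF this] show ?thesis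
    unfolding all_bool_eq long short by blast
qed

end
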